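(* Let $X^\alpha$, $\alpha\in L$, be a term with level set $\Omega_s=\{\omega_0,\dots,\omega_{s-1}\}$ on the full design $\mathcal D$, where $\omega_k=\exp(2\pi\mathrm{i}k/s)$. Let $\mathcal F$ be a fraction of $\mathcal D$, with or without replicates. For $k=0,\dots,s-1$ let $r_k$ be the number of times $X^\alpha$ takes the value $\omega_k$ on $\mathcal F$, and let $P(\zeta)=\sum_{k=0}^{s-1}r_k\zeta^k$, $\zeta\in\mathbb C$. (1) $X^\alpha$ is centered on $\mathcal F$ if, and only if, $P(\zeta)=\Phi_s(\zeta)\Psi(\zeta)$, where $\Phi_s$ is the cyclotomic polynomial of the $s$-th roots of unity and $\Psi$ is a suitable polynomial with integer coefficients. (2) Let $s$ be prime. Then the term $X^\alpha$ is centered on $\mathcal F$ if, and only if, its $s$ levels appear equally often: $r_0=\cdots=r_{s-1}=r$. (3) Let $s=p_1^{h_1}\cdots p_d^{h_d}$, with $p_i$ prime for $i=1,\dots,d$. The term $X^\alpha$ is centered on $\mathcal F$ if, and only if, the following equivalent conditions are satisfied: (a) the remainder $H(\zeta)=P(\zeta)\bmod\Phi_s(\zeta)$, whose coefficients are integer combinations of the $r_k$, $k=0,\dots,s-1$, is identically zero; (b) the polynomial of degree $s$ $$\tilde P(\zeta)=P(\zeta)\prod_{d\mid s}\Phi_d(\zeta)\bmod(\zeta^s-1),$$ whose coefficients are integer combinations of the replicates $r_k$, $k=0,\dots,s-1$, is identically zero; the indices of the product are the $d$'s that divide $s$. (4) Let each $g_i$ be an indicator of a subgroup or of a lateral of a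 subgroup of $\Omega_s$, i.e. $g_i=(g_{i0},\dots,g_{ij},\dots,g_{i,s-1})$, $g_{ij}\in\{0,1\}$, such that $\{k: g_{ik}=1\}$ (with $k$ identified with $\omega_k$) is a subgroup or a lateral of a subgroup of $\Omega_s$. If the vector of level replicates $(r_0,r_1,\dots,r_{s-1})$ is a combination with positive weights of the $g_i$, $$(r_0,r_1,\dots,r_{s-1})=\sum_i a_i\,g_i,\qquad a_i\in\mathbb N,$$ then $X^\alpha$ is centered on $\mathcal F$.
   Context: Let $n_1,\dots,n_m$ be the numbers of levels of the $m$ factors of a design. For a positive integer $n$, $\Omega_n\subset\mathbb C$ is the multiplicative group of $n$-th roots of unity. The full factorial design with complex coding is $\mathcal D=\Omega_{n_1}\times\cdots\times\Omega_{n_m}$ and the exponent set is $L=\mathbb Z_{n_1}\times\cdots\times\mathbb Z_{n_m}$, with elements $\alpha=(\alpha_1,\dots,\alpha_m)$, $\alpha_j\in\{0,\dots,n_j-1\}$. For $\alpha\in L$, the term $X^\alpha:\mathcal D\to\mathbb C$ is $X^\alpha(\zeta_1,\dots,\zeta_m)=\zeta_1^{\alpha_1}\cdots\zeta_m^{\alpha_m}$. "Level set $\Omega_s$ on $\mathcal D$" means that the set of values taken by $X^\alpha$ on $\mathcal D$ is $\Omega_s$. A fraction $\mathcal F$ is a (nonempty) multi-subset of $\mathcal D$ (points may be repeated), with counting function $R$: $R(\zeta)$ is the number of appearances of $\zeta\in\mathcal D$ in $\mathcal F$. All counts and sums over $\mathcal F$ are taken with multiplicity, and $\#\mathcal F=\sum_{\zeta\in\mathcal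 D}R(\zeta)$. The term $X^\alpha$ is centered on $\mathcal F$ if $E_{\mathcal F}(X^\alpha)=\frac1{\#\mathcal F}\sum_{\zeta\in\mathcal F}X^\alpha(\zeta)=0$. "$P\bmod Q$" is the remainder of the division of the polynomial $P$ by $Q$. $\Phi_d$ denotes the $d$-th cyclotomic polynomial, i.e. the monic polynomial whose (simple) roots are the primitive $d$-th roots of unity. A lateral of a subgroup is a coset of it.
   Formalization: In (3)(b) the product runs over the proper divisors d of s only (over all d | s it is ζ^s−1 and P̃ is always zero), and P̃ has degree less than s, not s; in (4) the subgroups must be nontrivial, since cosets of {1} give non-centered terms. *)

theory Defs
  imports
    Complex_Main
    "HOL-Library.FuncSet"
    "HOL-Library.Multiset"
    "HOL-Computational_Algebra.Computational_Algebra"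
    "HOL-Algebra.Coset"
begin

definition Omega :: "nat \<Rightarrow> complex set" where
  "Omega n = {z. z ^ n = 1}"

definition Omega_group :: "nat \<Rightarrow> complex monoid" where
  "Omega_group n = \<lparr>carrier = Omega n, monoid.mult = (*), one = 1\<rparr>"

definition omega :: "nat \<Rightarrow> nat \<Rightarrow> complex" where
  "omega s k = exp (2 * of_real pi * \<i> * of_nat k / of_nat s)"

text \<open>Points and exponents are extensional functions on the factor indices \<open>{1..m}\<close>;
  the exponents are represented by their residues in \<open>{0..<n j}\<close>.\<close>

definition full_design :: "nat \<Rightarrow> (nat \<Rightarrow> nat) \<Rightarrow> (nat \<Rightarrow> complex) set" where
  "full_design m n = (\<Pi>\<^sub>E j\<in>{1..m}. Omega (n j))"

definition exponents :: "nat \<Rightarrow> (nat \<Rightarrow> nat) \<Rightarrow> (nat \<Rightarrow> nat) set" where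
  "exponents m n = (\<Pi>\<^sub>E j\<in>{1..m}. {0..<n j})"

definition X_term :: "nat \<Rightarrow> (nat \<Rightarrow> nat) \<Rightarrow> (nat \<Rightarrow> complex) \<Rightarrow> complex" where
  "X_term m \<alpha> \<zeta> = (\<Prod>j\<in>{1..m}. \<zeta> j ^ \<alpha> j)"

definition fraction :: "nat \<Rightarrow> (nat \<Rightarrow> nat) \<Rightarrow> (nat \<Rightarrow> complex) multiset \<Rightarrow> bool" where
  "fraction m n F \<longleftrightarrow> F \<noteq> {#} \<and> set_mset F \<subseteq> full_design m n"

definition centered :: "('a \<Rightarrow> complex) \<Rightarrow> 'a multiset \<Rightarrow> bool" where
  "centered f F \<longleftrightarrow> (\<Sum>\<zeta>\<in>#F. f \<zeta>) / of_nat (size F) = 0"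

definition primitive_roots :: "nat \<Rightarrow> complex set" where
  "primitive_roots d = {z. z ^ d = 1 \<and> (\<forall>k. 0 < k \<and> k < d \<longrightarrow> z ^ k \<noteq> 1)}"

definition cyclotomic :: "nat \<Rightarrow> complex poly" where
  "cyclotomic d = (\<Prod>z\<in>primitive_roots d. [:- z, 1:])"

definition level_poly :: "nat \<Rightarrow> (nat \<Rightarrow> nat) \<Rightarrow> complex poly" where
  "level_poly s r = (\<Sum>k<s. monom (of_nat (r k)) k)"

definition remainder_poly :: "nat \<Rightarrow> (nat \<Rightarrow> nat) \<Rightarrow> complex poly" where
  "remainder_poly s r = level_poly s r mod cyclotomic s"

text \<open>The product ranges over the proper divisors of \<open>s\<close>: over all divisors it would be
  \<open>\<zeta> ^ s - 1\<close> itself, and the remainder would vanish for every \<open>r\<close>.\<close>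

definition tilde_poly :: "nat \<Rightarrow> (nat \<Rightarrow> nat) \<Rightarrow> complex poly" where
  "tilde_poly s r =
     (level_poly s r * (\<Prod>d\<in>{d. d dvd s \<and> d \<noteq> s}. cyclotomic d)) mod (monom 1 s - 1)"

text \<open>The subgroup has to be nontrivial: a coset of \<open>{1}\<close> is a single level, and the sum of
  its elements is not zero. The subgroup itself is one of its cosets.\<close>

definition lateral_indicator :: "nat \<Rightarrow> (nat \<Rightarrow> nat) \<Rightarrow> bool" where
  "lateral_indicator s g \<longleftrightarrow>
     (\<forall>k<s. g k \<in> {0, 1}) \<and>
     (\<exists>H. subgroup H (Omega_group s) \<and> H \<noteq> {1} \<and>
          omega s ` {k. k < s \<and> g k = 1} \<in> rcosets\<^bsub>Omega_group s\<^esub> H)"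

end

theory Submission
  imports Defs "HOL-Number_Theory.Cong"
begin

text \<open>
  Collecting the points of the fraction by level shows that the term is centered exactly if
  \<open>\<Sum>k<s. r k * \<omega>\<^sup>k = 0\<close> with \<open>\<omega> = omega s 1\<close>, that is, if the integer polynomial \<open>level_poly s r\<close>
  vanishes at the primitive \<open>s\<close>-th root of unity \<open>\<omega>\<close> (\<open>centered_iff_sum_levels\<close>). Everything about a
  general \<open>s\<close> rests on one arithmetic fact, \<open>omega_root_iff_cyclotomic_dvd\<close>: an integer polynomial
  vanishes at \<open>\<omega>\<close> if and only if it is an integral multiple of the \<open>s\<close>-th cyclotomic polynomial.

  This fact is the irreducibility of the cyclotomic polynomial in disguise. It is obtained from
  \<open>root_of_unity_conjugates\<close>, which says that \<open>P(z) = 0\<close> implies \<open>P(z\<^sup>m) = 0\<close> for an \<open>s\<close>-th root of unity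
  \<open>z\<close> and \<open>m\<close> coprime to \<open>s\<close>. The proof follows Landau: for a prime \<open>p\<close> the number \<open>P(z\<^sup>p)\<close> is congruent
  to \<open>P(z)\<^sup>p = 0\<close> modulo \<open>p\<close>, but it takes only finitely many values in \<open>\<int>[z]\<close>, and a nonzero element of
  that ring is not divisible by large integers (\<open>infinitely_divisible_imp_zero\<close>). Large primes therefore
  preserve the roots of \<open>P\<close>, and products of large primes reach every residue class coprime to \<open>s\<close>.

  The conditions on the two remainders are then restatements of the divisibility of \<open>level_poly s r\<close> by
  the cyclotomic polynomial, the second one through \<open>X\<^sup>s - 1 = (\<Prod>d | d dvd s. cyclotomic d)\<close>. For prime
  \<open>s\<close>, divisibility by \<open>1 + X + \<dots> + X\<^sup>s\<^sup>-\<^sup>1\<close> of a polynomial of degree below \<open>s\<close> forces equal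
  coefficients. The sufficient condition by cosets is elementary: the elements of a coset of a
  nontrivial group of roots of unity sum to zero, and the sum over the levels is linear in the counts.
\<close>

section \<open>Integer polynomials as complex polynomials\<close>

abbreviation complex_poly :: "int poly \<Rightarrow> complex poly" where
  "complex_poly \<equiv> map_poly of_int"

lemma complex_poly_add: "complex_poly (p + q) = complex_poly p + complex_poly q"
  by (simp add: poly_eq_iff coeff_map_poly)

lemma complex_poly_diff: "complex_poly (p - q) = complex_poly p - complex_poly q"
  by (simp add: poly_eq_iff coeff_map_poly)

lemma complex_poly_mult: "complex_poly (p * q) = complex_poly p * complex_poly q"
  by (simp add: poly_eq_iff coeff_map_poly coeff_mult)

lemma complex_poly_prod: "complex_poly (\<Prod>x\<in>A. f x) = (\<Prod>x\<in>A. complex_poly (f x))"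
  by (induction A rule: infinite_finite_induct) (simp_all add: complex_poly_mult)

lemma complex_poly_power: "complex_poly (p ^ n) = complex_poly p ^ n"
  by (induction n) (simp_all add: complex_poly_mult)

lemma complex_poly_const: "complex_poly [:a:] = [:of_int a:]"
  by (simp add: poly_eq_iff coeff_map_poly coeff_pCons split: nat.splits)

lemma complex_poly_smult: "complex_poly (smult a p) = smult (of_int a) (complex_poly p)"
  by (simp add: poly_eq_iff coeff_map_poly)

lemma complex_poly_eq_iff: "complex_poly p = complex_poly q \<longleftrightarrow> p = q"
  by (simp add: poly_eq_iff coeff_map_poly)

lemma degree_complex_poly: "degree (complex_poly p) = degree p"
  by (cases "p = 0") (simp_all add: map_poly_degree_eq)

lemma poly_complex_poly_pcompose_monom:
  "poly (complex_poly (pcompose p (monom 1 n))) z = poly (complex_poly p) (z ^ n)"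
proof (induction p)
  case (pCons a p)
  then show ?case
    by (simp add: pcompose_pCons complex_poly_add complex_poly_mult complex_poly_const
        map_poly_pCons map_poly_monom poly_monom)
qed simp

text \<open>Over the integers, division with remainder is possible by a monic divisor: the power of the leading
  coefficient that enters pseudo-division is then \<open>1\<close>.\<close>

lemma monic_int_division:
  fixes a b :: "int poly"
  assumes "lead_coeff b = 1"
  obtains q r where "a = b * q + r" "r = 0 \<or> degree r < degree b"
proof -
  have b: "b \<noteq> 0" using assms by auto
  obtain q r where qr: "pseudo_divmod a b = (q, r)" by fastforce
  show thesis using that[of q r] pseudo_divmod[OF b qr] assms by simp
qed

lemma complex_poly_mod_monic:
  assumes "lead_coeff b = 1" "a = b * q + r" "r = 0 \<or> degree r < degree b"
  shows "complex_poly a mod complex_poly b = complex_poly r"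
proof -
  have "complex_poly r mod complex_poly b = complex_poly r"
    using assms(3) by (cases "r = 0") (auto intro!: mod_poly_less simp: degree_complex_poly)
  then show ?thesis
    by (simp add: assms(2) complex_poly_add complex_poly_mult)
qed

text \<open>Division with remainder is unique over \<open>\<complex>\<close> and, for a monic divisor, can be carried out over
  \<open>\<int>\<close>; hence exact quotients of integer polynomials by monic ones are integral.\<close>

lemma complex_poly_div_monic:
  assumes "lead_coeff b = 1" "complex_poly a = complex_poly b * h"
  obtains q where "a = b * q" "h = complex_poly q"
proof -
  obtain q r where qr: "a = b * q + r" "r = 0 \<or> degree r < degree b"
    using monic_int_division[OF assms(1)] by blast
  have b: "complex_poly b \<noteq> 0"
    using assms(1) complex_poly_eq_iff[of b 0] by auto
  have "complex_poly r = 0"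
    using complex_poly_mod_monic[OF assms(1) qr] assms(2) by simp
  then have "r = 0"
    using complex_poly_eq_iff[of r 0] by simp
  then have a: "a = b * q" using qr by simp
  then have "complex_poly b * h = complex_poly b * complex_poly q"
    using assms(2) a complex_poly_mult by metis
  then show thesis using that[OF a] b by simp
qed

section \<open>Divisibility in the ring generated by an algebraic integer\<close>

text \<open>Among the nonzero integer polynomials that vanish at \<open>z\<close>, the primitive part \<open>f\<close> of one of least
  degree generates all: pseudo-division gives \<open>c p = f w\<close>, and Gauss's lemma removes the
  constant \<open>c\<close>. In particular \<open>f\<close> divides a monic polynomial, which makes \<open>f\<close> monic up to sign.\<close>

lemma algebraic_int_minimal_polynomial:
  fixes z :: complex
  assumes "algebraic_int z"
  obtains f :: "int poly" where "lead_coeff f = 1"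
    "\<And>p. poly (complex_poly p) z = 0 \<longleftrightarrow> f dvd p"
proof -
  define Z where "Z = {p :: int poly. p \<noteq> 0 \<and> poly (complex_poly p) z = 0}"
  \<comment> \<open>The witness of integrality will force the leading coefficient of the minimal polynomial to be a unit.\<close>
  obtain q where q: "poly (complex_poly q) z = 0" "lead_coeff q = 1"
    using assms unfolding algebraic_int_altdef_ipoly by auto
  have "q \<in> Z" using q by (auto simp: Z_def)
  then obtain g where g: "g \<in> Z" and min: "\<And>p. p \<in> Z \<Longrightarrow> degree g \<le> degree p"
    using ex_has_least_nat[of "\<lambda>p. p \<in> Z" q degree] by auto
  define f where "f = primitive_part g"
  have f0: "f \<noteq> 0" and cf: "content f = 1" and df: "degree f = degree g"
    using g by (auto simp: f_def Z_def)
  have "smult (content g) f = g" by (simp add: f_def)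
  then have "of_int (content g) * poly (complex_poly f) z = poly (complex_poly g) z"
    by (metis complex_poly_smult poly_smult)
  then have fz: "poly (complex_poly f) z = 0"
    using g by (auto simp: Z_def)
  have dvd: "f dvd p" if p: "poly (complex_poly p) z = 0" for p
  proof -
    obtain w r where wr: "pseudo_divmod p f = (w, r)" by fastforce
    define c where "c = lead_coeff f ^ (Suc (degree p) - degree f)"
    have c0: "c \<noteq> 0" using f0 by (simp add: c_def)
    have eq: "smult c p = f * w + r" and r: "r = 0 \<or> degree r < degree f"
      using pseudo_divmod[OF f0 wr] by (simp_all add: c_def)
    have "poly (complex_poly (smult c p)) z = poly (complex_poly (f * w + r)) z"
      by (simp only: eq)
    then have "poly (complex_poly r) z = 0"
      by (simp add: complex_poly_smult complex_poly_add complex_poly_mult p fz)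
    then have "r = 0"
      using r min[of r] df by (cases "r = 0") (auto simp: Z_def)
    then have eq: "smult c p = f * w" using eq by simp
    \<comment> \<open>Gauss: \<open>f\<close> is primitive, so the scalar \<open>c\<close> divides the content of the cofactor and cancels.\<close>
    then have "content (smult c p) = content (f * w)" by (rule arg_cong)
    then have "normalize c * content p = content w" by (simp only: content_smult content_mult cf mult_1)
    then have "normalize c dvd content w" by (rule dvdI[OF sym])
    then have "[:c:] dvd w" by (simp add: const_poly_dvd_iff_dvd_content)
    then obtain v where "w = [:c:] * v" by (rule dvdE)
    then have "smult c p = smult c (f * v)" using eq by simp
    then have "p = f * v" using c0 by (metis smult_cancel)
    then show ?thesis by simp
  qed
  have "f dvd q" using dvd q by blast
  then have unit: "is_unit (lead_coeff f)"
    using q(2) by (metis dvdE dvd_triv_left lead_coeff_mult)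
  \<comment> \<open>The leading coefficient is \<open>1\<close> or \<open>-1\<close>, hence its own inverse.\<close>
  define e where "e = smult (lead_coeff f) f"
  have "lead_coeff f * lead_coeff f = 1" using unit by (auto simp: zdvd1_eq abs_if split: if_splits)
  then have e1: "lead_coeff e = 1" and fe: "f = smult (lead_coeff f) e"
    by (auto simp: e_def)
  have ez: "poly (complex_poly e) z = 0" by (simp add: e_def complex_poly_smult fz)
  have "poly (complex_poly p) z = 0 \<longleftrightarrow> e dvd p" for p
  proof
    assume "poly (complex_poly p) z = 0"
    then have "smult (lead_coeff f) e dvd p" using dvd fe by simp
    then show "e dvd p" by (rule smult_dvd_cancel)
  next
    assume "e dvd p"
    then obtain q where "p = e * q" ..
    then show "poly (complex_poly p) z = 0" by (simp add: complex_poly_mult ez)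
  qed
  with e1 show thesis by (rule that)
qed

text \<open>By division by the monic minimal polynomial, the powers of \<open>z\<close> below its degree form a
  \<open>\<int>\<close>-basis of the ring \<open>\<int>[z]\<close>. If \<open>n\<close> divides an element there, then it divides
  each of its coordinates, so a nonzero element has no large integer divisors.\<close>

lemma infinitely_divisible_imp_zero:
  fixes z :: complex and Q :: "int poly"
  assumes "algebraic_int z"
  obtains A :: nat where
    "\<And>n g. n > A \<Longrightarrow> poly (complex_poly Q) z = of_nat n * poly (complex_poly g) z \<Longrightarrow>
       poly (complex_poly Q) z = 0"
proof -
  obtain f where f1: "lead_coeff f = 1"
    and f: "\<And>p. poly (complex_poly p) z = 0 \<longleftrightarrow> f dvd p"
    using algebraic_int_minimal_polynomial[OF assms] by blast
  obtain q R where R: "Q = f * q + R" "R = 0 \<or> degree R < degree f"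
    using monic_int_division[OF f1] by blast
  \<comment> \<open>A multiple of \<open>n\<close> of absolute value below \<open>n\<close> is zero; applied to the leading coefficient of
    \<open>R\<close>, this gives \<open>R = 0\<close>.\<close>
  define A where "A = nat \<bar>lead_coeff R\<bar>"
  have "poly (complex_poly Q) z = 0"
    if n: "n > A" and eq: "poly (complex_poly Q) z = of_nat n * poly (complex_poly g) z" for n g
  proof -
    obtain q' S where S: "g = f * q' + S" "S = 0 \<or> degree S < degree f"
      using monic_int_division[OF f1] by blast
    have "poly (complex_poly (Q - smult (int n) g)) z = 0"
      using eq by (simp add: complex_poly_diff complex_poly_smult)
    then have "f dvd Q - smult (int n) g" by (simp add: f)
    moreover have "Q - smult (int n) g = f * (q - smult (int n) q') + (R - smult (int n) S)"
      by (simp add: R(1) S(1) algebra_simps smult_add_right)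
    ultimately have "f dvd R - smult (int n) S"
      using dvd_add_right_iff[of f "f * (q - smult (int n) q')"] by simp
    moreover have "R - smult (int n) S = 0 \<or> degree (R - smult (int n) S) < degree f"
      using R(2) S(2) degree_smult_le[of "int n" S] degree_diff_less[of R "degree f" "smult (int n) S"]
      by (cases "R = 0"; cases "S = 0") auto
    ultimately have "R = smult (int n) S"
      using dvd_imp_degree_le[of f "R - smult (int n) S"] by (cases "R = smult (int n) S") auto
    then have "int n dvd lead_coeff R" by simp
    then have "lead_coeff R = 0"
      using n dvd_imp_le_int[of "lead_coeff R" "int n"] unfolding A_def by linarith
    then have "f dvd Q" using R by simp
    then show ?thesis by (simp add: f)
  qed
  then show thesis by (rule that)
qed

section \<open>The Frobenius congruence\<close>

lemma prime_dvd_freshmans_dream: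
  fixes x y :: "'a :: comm_ring_1"
  assumes "prime p"
  shows "of_nat p dvd (x + y) ^ p - (x ^ p + y ^ p)"
proof -
  have p: "p > 0" using assms prime_gt_0_nat by blast
  have "(x + y) ^ p = (\<Sum>k\<in>insert 0 (insert p {0<..<p}). of_nat (p choose k) * x ^ k * y ^ (p - k))"
    unfolding binomial_ring by (rule sum.cong) auto
  also have "\<dots> = x ^ p + y ^ p + (\<Sum>k\<in>{0<..<p}. of_nat (p choose k) * x ^ k * y ^ (p - k))"
    using p by (simp add: add_ac)
  finally have "(x + y) ^ p - (x ^ p + y ^ p) = (\<Sum>k\<in>{0<..<p}. of_nat (p choose k) * x ^ k * y ^ (p - k))"
    by simp
  also have "of_nat p dvd \<dots>"
  proof (rule dvd_sum)
    fix k assume "k \<in> {0<..<p}"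
    then have "p dvd p choose k" using dvd_choose_prime[of k p] assms by auto
    then have "(of_nat p :: 'a) dvd of_nat (p choose k)" by (metis dvd_def of_nat_mult)
    then show "of_nat p dvd of_nat (p choose k) * x ^ k * y ^ (p - k)" by simp
  qed
  finally show ?thesis .
qed

lemma prime_dvd_power_minus_self:
  fixes a :: int
  assumes "prime p"
  shows "int p dvd a ^ p - a"
proof (induction a rule: int_induct[where k = 0])
  case base
  then show ?case using assms prime_gt_0_nat by (simp add: zero_power)
next
  case (step1 i)
  have "(i + 1) ^ p - (i + 1) = ((i + 1) ^ p - (i ^ p + 1 ^ p)) + (i ^ p - i)" by simp
  then show ?case using step1 prime_dvd_freshmans_dream[OF assms, of i 1] by (metis dvd_add)
next
  case (step2 i)
  have "(i - 1) ^ p - (i - 1) = (i ^ p - i) - ((i - 1 + 1) ^ p - ((i - 1) ^ p + 1 ^ p))" by simp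
  then show ?case using step2 prime_dvd_freshmans_dream[OF assms, of "i - 1" 1] by (metis dvd_diff)
qed

text \<open>The congruence \<open>P(X\<^sup>p) \<equiv> P(X)\<^sup>p (mod p)\<close> holds for constants by Fermat's little theorem
  and for \<open>X\<close> trivially. It passes to products and, because the inner binomial coefficients are
  divisible by \<open>p\<close>, to sums.\<close>

lemma prime_dvd_pcompose_monom_minus_power:
  fixes P :: "int poly"
  assumes "prime p"
  shows "of_nat p dvd pcompose P (monom 1 p) - P ^ p"
proof (induction P)
  case 0
  then show ?case using assms prime_gt_0_nat by (simp add: zero_power)
next
  case (pCons a P)
  let ?X = "[:0, 1:] :: int poly"
  have P: "pCons a P = [:a:] + ?X * P" by simp
  have X: "monom 1 p = ?X ^ p" by (simp add: monom_altdef)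
  have "pcompose (pCons a P) (monom 1 p) - pCons a P ^ p =
      ([:a:] - [:a:] ^ p) + ?X ^ p * (pcompose P (monom 1 p) - P ^ p)
      - (([:a:] + ?X * P) ^ p - ([:a:] ^ p + (?X * P) ^ p))"
    unfolding pcompose_pCons X by (subst P, simp only: power_mult_distrib) (simp only: algebra_simps)
  moreover have "of_nat p dvd [:a:] - [:a:] ^ p"
  proof -
    obtain c where c: "a ^ p - a = int p * c" using prime_dvd_power_minus_self[OF assms] by blast
    have "[:a:] - [:a:] ^ p = of_nat p * [:- c:]"
      using c by (simp add: poly_const_pow of_nat_poly algebra_simps)
    then show ?thesis by (rule dvdI)
  qed
  moreover have "of_nat p dvd ?X ^ p * (pcompose P (monom 1 p) - P ^ p)"
    using pCons.IH by (rule dvd_mult)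
  ultimately show ?case
    using prime_dvd_freshmans_dream[OF assms, of "[:a:]" "?X * P"] by (metis dvd_add dvd_diff)
qed

section \<open>Conjugates of roots of unity\<close>

text \<open>This allows arguments that work only for large primes to reach every residue class that is
  coprime to \<open>s\<close>, without Dirichlet's theorem on primes in arithmetic progressions.\<close>

lemma coprime_residue_with_large_prime_factors:
  fixes m s A :: nat
  assumes "coprime m s" "s > 0"
  obtains m' where "m' > 0" "[m' = m] (mod s)" "\<And>q. prime q \<Longrightarrow> q dvd m' \<Longrightarrow> q > A"
proof -
  define B where "B = {q. prime q \<and> q \<le> A \<and> \<not> q dvd m}"
  have B: "finite B" by (rule finite_subset[of _ "{..A}"]) (auto simp: B_def)
  \<comment> \<open>A prime \<open>q \<le> A\<close> divides exactly one of the two summands: if it divides \<open>m\<close>, it divides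
    neither \<open>s\<close> (coprimality) nor \<open>\<Prod>B\<close>; otherwise it is a factor of \<open>\<Prod>B\<close>.\<close>
  define m' where "m' = m + s * \<Prod>B"
  have "q > A" if q: "prime q" "q dvd m'" for q
  proof (rule ccontr)
    assume "\<not> q > A"
    show False
    proof (cases "q dvd m")
      case True
      then have "q dvd s * \<Prod>B" using q(2) by (simp add: m'_def dvd_add_right_iff)
      moreover have "\<not> q dvd s"
        using True assms(1) q(1) coprime_common_divisor not_prime_unit by blast
      moreover have "\<not> q dvd b" if "b \<in> B" for b
        using that True q(1) primes_dvd_imp_eq[of q b] by (auto simp: B_def)
      ultimately show False
        using q(1) B by (auto simp: prime_dvd_mult_iff prime_dvd_prod_iff)
    next
      case False
      then have "q dvd \<Prod>B" using \<open>\<not> q > A\<close> q(1) B by (intro dvd_prodI) (auto simp: B_def)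
      then have "q dvd m" using q(2) by (simp add: m'_def dvd_add_left_iff)
      then show False using False by simp
    qed
  qed
  moreover have "\<Prod>B > 0" using B by (intro prod_pos) (auto simp: B_def prime_gt_0_nat)
  ultimately show thesis
    using that[of m'] assms(2) by (simp add: m'_def cong_def)
qed

text \<open>Landau's argument for the irreducibility of the cyclotomic polynomials. If \<open>P(w) = 0\<close> then, by the
  Frobenius congruence, \<open>P(w\<^sup>p)\<close> is \<open>p\<close> times an element of \<open>\<int>[w]\<close>. Only finitely many
  values \<open>P(w\<^sup>p)\<close> exist, and the nonzero ones are not divisible by large primes, so \<open>P(w\<^sup>p) = 0\<close>
  for every prime \<open>p\<close> beyond a bound that is independent of \<open>w\<close>. Iterating over the prime factors gives
  every exponent without small prime factors, and every class coprime to \<open>s\<close> contains such an exponent.\<close>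

lemma root_of_unity_conjugates:
  fixes z :: complex and P :: "int poly"
  assumes "z ^ s = 1" "s > 0" "coprime m s" "poly (complex_poly P) z = 0"
  shows "poly (complex_poly P) (z ^ m) = 0"
proof -
  let ?U = "{w :: complex. w ^ s = 1}"
  have algint: "algebraic_int w" if "w \<in> ?U" for w
    using that assms(2) by (intro algebraic_int_root[of 1 "monom 1 s" w])
      (auto simp: poly_monom coeff_monom degree_monom_eq)
  have "\<exists>A. \<forall>n>A. \<forall>g. poly (complex_poly (pcompose P (monom 1 k))) w = of_nat n * poly (complex_poly g) w \<longrightarrow>
       poly (complex_poly (pcompose P (monom 1 k))) w = 0" if "w \<in> ?U" for w k
    using infinitely_divisible_imp_zero[OF algint[OF that]] by metis
  then obtain A where A: "\<And>w k n g. w \<in> ?U \<Longrightarrow> n > A w k \<Longrightarrow>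
     poly (complex_poly (pcompose P (monom 1 k))) w = of_nat n * poly (complex_poly g) w \<Longrightarrow>
       poly (complex_poly (pcompose P (monom 1 k))) w = 0"
    by metis
  have U: "finite ?U" using assms(2) by (intro finite_roots_unity) simp
  \<comment> \<open>Exponents matter only modulo \<open>s\<close>, so finitely many elements \<open>P(w\<^sup>k)\<close> arise and one bound
    serves them all.\<close>
  define M where "M = Max ((\<lambda>(w, k). A w k) ` (?U \<times> {..<s}))"
  have M: "A w k \<le> M" if "w \<in> ?U" "k < s" for w k
    unfolding M_def using that U by (intro Max_ge) auto
  have power_mod: "w ^ (k mod s) = w ^ k" if "w \<in> ?U" for w k
  proof -
    have "w ^ k = w ^ (s * (k div s) + k mod s)" by simp
    also have "\<dots> = w ^ (k mod s)" using that by (simp only: power_add power_mult) simp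
    finally show ?thesis by simp
  qed
  have prime_step: "poly (complex_poly P) (w ^ p) = 0"
    if w: "w \<in> ?U" and P: "poly (complex_poly P) w = 0" and p: "prime p" "p > M" for w p
  proof -
    obtain g where "pcompose P (monom 1 p) - P ^ p = of_nat p * g"
      using prime_dvd_pcompose_monom_minus_power[OF p(1)] by blast
    then have "pcompose P (monom 1 p) = P ^ p + smult (int p) g"
      by (simp add: algebra_simps of_nat_poly)
    then have eq: "poly (complex_poly P) (w ^ p) = of_nat p * poly (complex_poly g) w"
      using P p(1) prime_gt_0_nat[of p]
      by (simp flip: poly_complex_poly_pcompose_monom
          add: complex_poly_add complex_poly_power complex_poly_smult zero_power)
    \<comment> \<open>\<open>P(w\<^sup>p)\<close> is one of those elements, and it is divisible by the large number \<open>p\<close>.\<close>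
    have "p > A w (p mod s)" using M[OF w, of "p mod s"] p(2) assms(2) by simp
    then show ?thesis
      using A[OF w, of "p mod s" p g] eq by (simp add: poly_complex_poly_pcompose_monom power_mod[OF w])
  qed
  have "poly (complex_poly P) (w ^ k) = 0"
    if "k > 0" "\<And>q. prime q \<Longrightarrow> q dvd k \<Longrightarrow> q > M" "w \<in> ?U" "poly (complex_poly P) w = 0" for w k
    using that
  proof (induction k arbitrary: w rule: prime_divisors_induct)
    case (factor p k)
    have "w ^ p \<in> ?U" using factor.prems(3) by (simp add: power_commutes flip: power_mult)
      (simp add: mult.commute[of p] power_mult)
    moreover have "poly (complex_poly P) (w ^ p) = 0"
      using factor by (intro prime_step) auto
    ultimately show ?case using factor.IH[of "w ^ p"] factor.prems by (simp add: power_mult)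
  qed auto
  moreover obtain m' where "m' > 0" "[m' = m] (mod s)" "\<And>q. prime q \<Longrightarrow> q dvd m' \<Longrightarrow> q > M"
    using coprime_residue_with_large_prime_factors[OF assms(3,2)] by blast
  ultimately have "poly (complex_poly P) (z ^ m') = 0" using assms by blast
  moreover have "z ^ m' = z ^ m"
    using power_mod[of z m] power_mod[of z m'] assms(1) \<open>[m' = m] (mod s)\<close> by (simp add: cong_def)
  ultimately show ?thesis by simp
qed

section \<open>Cyclotomic polynomials\<close>

lemma prod_linear_factors_dvd:
  fixes p :: "complex poly"
  assumes "finite Z" "\<And>z. z \<in> Z \<Longrightarrow> poly p z = 0"
  shows "(\<Prod>z\<in>Z. [:- z, 1:]) dvd p"
  using assms
proof (induction Z rule: finite_induct)
  case (insert z Z)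
  then obtain q where q: "p = (\<Prod>z\<in>Z. [:- z, 1:]) * q" by auto
  have "poly (\<Prod>z\<in>Z. [:- z, 1:]) z \<noteq> 0"
    using insert.hyps by (auto simp: poly_prod)
  then have "poly q z = 0" using insert.prems[of z] q by simp
  then have "[:- z, 1:] dvd q" by (simp add: poly_eq_0_iff_dvd)
  then show ?case
    using insert.hyps by (simp add: q mult.commute mult_dvd_mono del: mult_pCons_left mult_pCons_right)
qed simp

lemma monic_monom_minus_one:
  assumes "s > 0"
  shows "degree (monom 1 s - 1 :: 'a :: comm_ring_1 poly) = s"
    and "lead_coeff (monom 1 s - 1 :: 'a poly) = 1"
proof -
  have "degree (monom 1 s + - 1 :: 'a poly) = degree (monom 1 s :: 'a poly)"
    using assms by (intro degree_add_eq_left) (simp add: degree_monom_eq)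
  then show d: "degree (monom 1 s - 1 :: 'a poly) = s" by (simp add: degree_monom_eq)
  show "lead_coeff (monom 1 s - 1 :: 'a poly) = 1" using assms by (simp add: d coeff_monom)
qed

lemma monom_minus_one_eq_prod_roots:
  assumes "s > 0"
  shows "monom 1 s - 1 = (\<Prod>z | z ^ s = 1. [:- z, 1 :: complex:])"
proof -
  let ?U = "{z :: complex. z ^ s = 1}" and ?p = "monom 1 s - 1 :: complex poly"
  have U: "finite ?U" using assms by (intro finite_roots_unity) simp
  have "(\<Prod>z\<in>?U. [:- z, 1:]) dvd ?p"
    using U by (rule prod_linear_factors_dvd) (simp add: poly_monom)
  then obtain q where q: "?p = (\<Prod>z\<in>?U. [:- z, 1:]) * q" ..
  have lc: "lead_coeff (\<Prod>z\<in>?U. [:- z, 1:]) = 1" by (simp add: lead_coeff_prod)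
  have dg: "degree (\<Prod>z\<in>?U. [:- z, 1:]) = s"
    using card_roots_unity_eq[OF assms] by (simp add: degree_prod_eq_sum_degree)
  have "q \<noteq> 0" using q monic_monom_minus_one(2)[OF assms, where 'a = complex] by auto
  then have "degree ?p = s + degree q"
    unfolding q using lc dg by (subst degree_mult_eq) auto
  then have "degree q = 0" using monic_monom_minus_one(1)[OF assms, where 'a = complex] by simp
  moreover have "lead_coeff q = 1"
    using arg_cong[OF q, of lead_coeff] lc monic_monom_minus_one(2)[OF assms, where 'a = complex]
    by (simp only: lead_coeff_mult mult_1)
  ultimately have "q = 1" by (auto elim!: degree_eq_zeroE simp: one_pCons)
  then show ?thesis using q by simp
qed

text \<open>The order of an \<open>s\<close>-th root of unity divides \<open>s\<close>.\<close>

lemma roots_of_unity_eq_UN_primitive_roots: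
  assumes "s > 0"
  shows "{z. z ^ s = 1} = (\<Union>d\<in>{d. d dvd s}. primitive_roots d)"
proof (intro equalityI subsetI)
  fix z :: complex assume "z \<in> {z. z ^ s = 1}"
  then have z: "z ^ s = 1" by simp
  define d where "d = (LEAST k. k > 0 \<and> z ^ k = 1)"
  have d: "d > 0" "z ^ d = 1" using LeastI[of "\<lambda>k. k > 0 \<and> z ^ k = 1" s] assms z by (auto simp: d_def)
  have least: "z ^ k \<noteq> 1" if "0 < k" "k < d" for k
    using not_less_Least[of k "\<lambda>k. k > 0 \<and> z ^ k = 1"] that by (auto simp: d_def)
  have "z ^ s = z ^ (d * (s div d) + s mod d)" by simp
  also have "\<dots> = z ^ (s mod d)" using d(2) by (simp only: power_add power_mult) simp
  finally have "s mod d = 0" using least[of "s mod d"] d(1) z by auto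
  then have "d dvd s" by auto
  moreover have "z \<in> primitive_roots d" using d least by (auto simp: primitive_roots_def)
  ultimately show "z \<in> (\<Union>d\<in>{d. d dvd s}. primitive_roots d)" by blast
next
  fix z assume "z \<in> (\<Union>d\<in>{d. d dvd s}. primitive_roots d)"
  then show "z \<in> {z. z ^ s = 1}" by (auto simp: primitive_roots_def power_mult elim!: dvdE)
qed

lemma finite_primitive_roots: "d > 0 \<Longrightarrow> finite (primitive_roots d)"
  by (rule finite_subset[OF _ finite_roots_unity[of d]]) (auto simp: primitive_roots_def)

lemma lead_coeff_cyclotomic: "lead_coeff (cyclotomic d) = 1"
  by (simp add: cyclotomic_def lead_coeff_prod)

lemma prod_cyclotomic:
  assumes "s > 0"
  shows "(\<Prod>d | d dvd s. cyclotomic d) = monom 1 s - 1"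
proof -
  have pos: "d > 0" if "d dvd s" for d using that assms by (rule dvd_pos_nat[rotated])
  have "(\<Prod>d | d dvd s. cyclotomic d) = (\<Prod>z\<in>(\<Union>d\<in>{d. d dvd s}. primitive_roots d). [:- z, 1:])"
    unfolding cyclotomic_def
  proof (rule prod.UNION_disjoint [symmetric])
    show "\<forall>d\<in>{d. d dvd s}. finite (primitive_roots d)"
      using pos finite_primitive_roots by blast
    show "\<forall>d\<in>{d. d dvd s}. \<forall>e\<in>{d. d dvd s}. d \<noteq> e \<longrightarrow> primitive_roots d \<inter> primitive_roots e = {}"
    proof (intro ballI impI)
      fix d e assume "d \<in> {d. d dvd s}" "e \<in> {d. d dvd s}" "d \<noteq> e"
      then have "d > 0" "e > 0" "d < e \<or> e < d" using pos by auto
      then show "primitive_roots d \<inter> primitive_roots e = {}" by (auto simp: primitive_roots_def)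
    qed
  qed (use assms in auto)
  then show ?thesis
    using monom_minus_one_eq_prod_roots[OF assms] roots_of_unity_eq_UN_primitive_roots[OF assms] by simp
qed

lemma cyclotomic_mult_proper_divisors:
  assumes "s > 0"
  shows "cyclotomic s * (\<Prod>d\<in>{d. d dvd s \<and> d \<noteq> s}. cyclotomic d) = monom 1 s - 1"
proof -
  have "{d. d dvd s} = insert s {d. d dvd s \<and> d \<noteq> s}" by auto
  moreover have "finite {d. d dvd s \<and> d \<noteq> s}"
    by (rule finite_subset[OF _ finite_divisors_nat[OF assms]]) auto
  ultimately show ?thesis using prod_cyclotomic[OF assms] by simp
qed

text \<open>By induction on \<open>s\<close>: the product over the proper divisors is integral and monic, and the quotient of
  \<open>X\<^sup>s - 1\<close> by it is the cyclotomic polynomial.\<close>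

lemma cyclotomic_integral:
  assumes "s > 0"
  obtains c where "cyclotomic s = complex_poly c" "lead_coeff c = 1"
proof -
  have "\<exists>c. cyclotomic s = complex_poly c"
    using assms
  proof (induction s rule: less_induct)
    case (less s)
    let ?D = "{d. d dvd s \<and> d \<noteq> s}"
    have "\<forall>d\<in>?D. \<exists>c. cyclotomic d = complex_poly c"
    proof
      fix d assume "d \<in> ?D"
      then have "d < s" "d > 0" using less.prems dvd_imp_le[of d s] dvd_pos_nat[of s d] by auto
      then show "\<exists>c. cyclotomic d = complex_poly c" by (rule less.IH)
    qed
    then obtain c where c: "\<And>d. d \<in> ?D \<Longrightarrow> cyclotomic d = complex_poly (c d)"
      by metis
    have prod: "(\<Prod>d\<in>?D. cyclotomic d) = complex_poly (\<Prod>d\<in>?D. c d)"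
      by (simp add: c complex_poly_prod)
    have "lead_coeff (\<Prod>d\<in>?D. cyclotomic d) = 1"
      by (simp add: lead_coeff_prod lead_coeff_cyclotomic)
    then have monic: "lead_coeff (\<Prod>d\<in>?D. c d) = 1"
      unfolding prod by (simp add: degree_complex_poly coeff_map_poly)
    have "complex_poly (monom 1 s - 1) = complex_poly (\<Prod>d\<in>?D. c d) * cyclotomic s"
      using cyclotomic_mult_proper_divisors[OF less.prems]
      by (simp add: prod complex_poly_diff map_poly_monom mult.commute)
    then show ?case using complex_poly_div_monic[OF monic] by blast
  qed
  then obtain c where c: "cyclotomic s = complex_poly c" ..
  moreover have "lead_coeff c = 1"
    using lead_coeff_cyclotomic[of s] unfolding c by (simp add: degree_complex_poly coeff_map_poly)
  ultimately show thesis by (rule that)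
qed

lemma omega_power: "omega s k = omega s 1 ^ k"
  by (simp add: omega_def exp_of_nat_mult[symmetric] mult_ac)

lemma bij_betw_omega:
  assumes "s > 0"
  shows "bij_betw (omega s) {..<s} (Omega s)"
proof -
  have "omega s = (\<lambda>k. cis (2 * pi * real k / real s))"
    by (auto simp: omega_def cis_conv_exp mult_ac)
  then show ?thesis using Complex.bij_betw_roots_unity[OF assms] by (simp add: Omega_def)
qed

lemma omega_1_primitive:
  assumes "s > 0"
  shows "omega s 1 \<in> primitive_roots s"
proof -
  have "omega s 0 = 1" by (simp add: omega_def)
  have "omega s 1 ^ s = 1" by (simp add: omega_def assms flip: exp_of_nat_mult)
  moreover have "omega s 1 ^ k \<noteq> 1" if "0 < k" "k < s" for k
  proof
    assume "omega s 1 ^ k = 1"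
    then have "omega s k = omega s 0" using \<open>omega s 0 = 1\<close> omega_power[of s k] by simp
    then have "k = 0"
      using bij_betw_imp_inj_on[OF bij_betw_omega[OF assms]] that(2) assms by (auto dest: inj_onD)
    then show False using that(1) by simp
  qed
  ultimately show ?thesis by (simp add: primitive_roots_def)
qed

lemma primitive_root_is_coprime_power:
  assumes "s > 0" "w \<in> primitive_roots s"
  obtains k where "w = omega s 1 ^ k" "coprime k s"
proof -
  have w: "w ^ s = 1" "\<And>k. 0 < k \<Longrightarrow> k < s \<Longrightarrow> w ^ k \<noteq> 1" using assms(2) by (auto simp: primitive_roots_def)
  then have "w \<in> omega s ` {..<s}"
    using bij_betw_omega[OF assms(1)] by (simp add: bij_betw_def Omega_def)
  then obtain k where k: "w = omega s 1 ^ k" using omega_power by blast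
  have "coprime k s"
  proof (rule ccontr)
    \<comment> \<open>A common factor of \<open>k\<close> and \<open>s\<close> would make the order of \<open>w\<close> a proper divisor of \<open>s\<close>.\<close>
    assume "\<not> coprime k s"
    then have g: "gcd k s \<noteq> 1" by (simp add: coprime_iff_gcd_eq_1)
    have s: "s = gcd k s * (s div gcd k s)" and ks: "k * (s div gcd k s) = s * (k div gcd k s)"
      by (simp_all add: div_mult_swap dvd_div_mult mult.commute)
    have "w ^ (s div gcd k s) = omega s 1 ^ (s * (k div gcd k s))"
      by (simp only: k ks flip: power_mult)
    also have "\<dots> = 1"
      using omega_1_primitive[OF assms(1)] by (simp add: primitive_roots_def power_mult)
    finally have "w ^ (s div gcd k s) = 1" .
    moreover have "0 < s div gcd k s" using s assms(1) by (metis gr0I mult_0_right less_irrefl)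
    moreover have "s div gcd k s < s" using g assms(1) by (intro div_less_dividend) (auto simp: Suc_lessI)
    ultimately show False using w(2) by blast
  qed
  then show thesis using that k by blast
qed

text \<open>An integer polynomial that vanishes at one primitive root vanishes at all of them, since these are
  conjugate; hence the product of their linear factors divides it. The quotient is integral because the
  cyclotomic polynomial is monic with integer coefficients.\<close>

theorem omega_root_iff_cyclotomic_dvd:
  assumes "s > 0"
  shows "poly (complex_poly P) (omega s 1) = 0 \<longleftrightarrow>
    (\<exists>\<Psi>. complex_poly P = cyclotomic s * complex_poly \<Psi>)"
proof
  assume P: "poly (complex_poly P) (omega s 1) = 0"
  have "poly (complex_poly P) w = 0" if w: "w \<in> primitive_roots s" for w
  proof -
    obtain k where k: "w = omega s 1 ^ k" "coprime k s"
      using primitive_root_is_coprime_power[OF assms w] .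
    have "omega s 1 ^ s = 1" using omega_1_primitive[OF assms] by (simp add: primitive_roots_def)
    then show ?thesis using root_of_unity_conjugates[OF _ assms k(2) P] k(1) by simp
  qed
  then have "cyclotomic s dvd complex_poly P"
    unfolding cyclotomic_def using finite_primitive_roots[OF assms] by (intro prod_linear_factors_dvd)
  then obtain h where h: "complex_poly P = cyclotomic s * h" ..
  obtain c where c: "cyclotomic s = complex_poly c" "lead_coeff c = 1"
    using cyclotomic_integral[OF assms] .
  show "\<exists>\<Psi>. complex_poly P = cyclotomic s * complex_poly \<Psi>"
    using complex_poly_div_monic[OF c(2)] h unfolding c(1) by metis
next
  assume "\<exists>\<Psi>. complex_poly P = cyclotomic s * complex_poly \<Psi>"
  then obtain \<Psi> where \<Psi>: "complex_poly P = cyclotomic s * complex_poly \<Psi>" ..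
  have "poly (cyclotomic s) (omega s 1) = 0"
    using omega_1_primitive[OF assms] finite_primitive_roots[OF assms]
    by (auto simp: cyclotomic_def poly_prod)
  then show "poly (complex_poly P) (omega s 1) = 0" by (simp add: \<Psi>)
qed

section \<open>Level counts and their polynomial\<close>

lemma coeff_level_poly: "coeff (level_poly s r) k = (if k < s then of_nat (r k) else 0)"
  by (simp add: level_poly_def coeff_sum coeff_monom)

lemma level_poly_integral: "level_poly s r = complex_poly (\<Sum>k<s. monom (int (r k)) k)"
  by (simp add: poly_eq_iff coeff_level_poly coeff_map_poly coeff_sum coeff_monom)

lemma poly_level_poly_omega: "poly (level_poly s r) (omega s 1) = (\<Sum>k<s. of_nat (r k) * omega s k)"
proof -
  have "omega s 1 ^ k = omega s k" for k by (rule omega_power [symmetric])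
  then show ?thesis by (simp add: level_poly_def poly_sum poly_monom del: One_nat_def)
qed

lemma centered_iff_sum_levels:
  assumes "s > 0" "X_term m \<alpha> ` full_design m n = Omega s" "fraction m n F"
    and r: "\<forall>k<s. r k = size {#\<zeta> \<in># F. X_term m \<alpha> \<zeta> = omega s k#}"
  shows "centered (X_term m \<alpha>) F \<longleftrightarrow> (\<Sum>k<s. of_nat (r k) * omega s k) = 0"
proof -
  have sum: "(\<Sum>\<zeta>\<in>#G. f \<zeta>) = (\<Sum>k<s. of_nat (size {#\<zeta> \<in># G. f \<zeta> = omega s k#}) * omega s k)"
    if "f ` set_mset G \<subseteq> Omega s" for G and f :: "(nat \<Rightarrow> complex) \<Rightarrow> complex"
    using that
  proof (induction G)
    case (add x G)
    then have "f x \<in> omega s ` {..<s}" using bij_betw_omega[OF assms(1)] by (simp add: bij_betw_def)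
    then obtain l where l: "l < s" "f x = omega s l" by auto
    have eq: "f x = omega s k \<longleftrightarrow> k = l" if "k < s" for k
      using bij_betw_omega[OF assms(1)] l that by (auto simp: bij_betw_def inj_on_def)
    have "(\<Sum>k<s. of_nat (size {#\<zeta> \<in># add_mset x G. f \<zeta> = omega s k#}) * omega s k) =
      (\<Sum>k<s. (if k = l then omega s k else 0) + of_nat (size {#\<zeta> \<in># G. f \<zeta> = omega s k#}) * omega s k)"
      by (rule sum.cong) (auto simp: eq algebra_simps)
    then show ?case using add l by (simp add: sum.distrib)
  qed simp
  have "X_term m \<alpha> ` set_mset F \<subseteq> Omega s" "F \<noteq> {#}"
    using assms(2,3) by (auto simp: fraction_def)
  then show ?thesis using r by (simp add: centered_def sum)
qed

text \<open>The remainder depends linearly on the counts, and the remainders of the individual products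
  \<open>X\<^sup>k a\<close> are integral because the divisor is monic.\<close>

lemma coeff_mod_integral_combination:
  assumes "lead_coeff b = 1"
  shows "\<exists>c :: nat \<Rightarrow> nat \<Rightarrow> int. \<forall>r' j.
    coeff (level_poly s r' * complex_poly a mod complex_poly b) j = (\<Sum>k<s. of_int (c j k) * of_nat (r' k))"
proof -
  have "\<exists>R. complex_poly (monom 1 k * a) mod complex_poly b = complex_poly R" for k
    using monic_int_division[OF assms, of "monom 1 k * a"] complex_poly_mod_monic[OF assms] by metis
  then obtain R where R: "\<And>k. complex_poly (monom 1 k * a) mod complex_poly b = complex_poly (R k)"
    by metis
  have mod_sum: "(\<Sum>k\<in>K. f k) mod d = (\<Sum>k\<in>K. f k mod d)" for K :: "nat set" and f and d :: "complex poly"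
    by (induction K rule: infinite_finite_induct) (simp_all add: poly_mod_add_left)
  have "level_poly s r' * complex_poly a mod complex_poly b = (\<Sum>k<s. smult (of_nat (r' k)) (complex_poly (R k)))" for r'
  proof -
    have "monom (of_nat (r' k)) k * complex_poly a = smult (of_nat (r' k)) (complex_poly (monom 1 k * a))" for k
      by (simp add: complex_poly_mult map_poly_monom smult_monom flip: mult_smult_left)
    then have "level_poly s r' * complex_poly a = (\<Sum>k<s. smult (of_nat (r' k)) (complex_poly (monom 1 k * a)))"
      by (simp add: level_poly_def sum_distrib_right)
    then show ?thesis by (simp add: mod_sum mod_smult_left R)
  qed
  then have "\<forall>r' j. coeff (level_poly s r' * complex_poly a mod complex_poly b) j = (\<Sum>k<s. of_int (coeff (R k) j) * of_nat (r' k))"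
    by (simp add: coeff_sum coeff_map_poly mult.commute)
  then show ?thesis by (intro exI[of _ "\<lambda>j k. coeff (R k) j"])
qed

lemma cyclotomic_prime:
  assumes "prime s"
  shows "cyclotomic s = level_poly s (\<lambda>_. 1)"
proof -
  have s: "s > 0" using assms prime_gt_0_nat by blast
  have "{d. d dvd s \<and> d \<noteq> s} = {1}" using assms by (auto simp: prime_nat_iff)
  moreover have "primitive_roots 1 = {1}" by (auto simp: primitive_roots_def)
  ultimately have "cyclotomic s * [:- 1, 1:] = monom 1 s - 1"
    using cyclotomic_mult_proper_divisors[OF s] by (simp add: cyclotomic_def)
  also have "\<dots> = (monom 1 1 - 1) * (\<Sum>k<s. monom 1 1 ^ k)"
    using power_diff_1_eq[of "monom 1 1 :: complex poly" s] by (simp add: monom_power)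
  also have "\<dots> = level_poly s (\<lambda>_. 1) * [:- 1, 1:]"
    by (simp add: level_poly_def monom_power monom_altdef one_pCons)
  finally show ?thesis by (rule mult_right_cancel [THEN iffD1, rotated]) simp
qed

text \<open>For prime \<open>s\<close> the cyclotomic polynomial is \<open>1 + X + \<dots> + X\<^sup>s\<^sup>-\<^sup>1\<close>, of degree \<open>s - 1\<close>, so its
  only multiples of degree below \<open>s\<close> are the constant ones.\<close>

lemma cyclotomic_prime_dvd_level_poly_iff:
  assumes "prime s"
  shows "cyclotomic s dvd level_poly s r \<longleftrightarrow> (\<exists>r0. \<forall>k<s. r k = r0)"
proof
  assume "cyclotomic s dvd level_poly s r"
  then obtain q where q: "level_poly s r = level_poly s (\<lambda>_. 1) * q" unfolding cyclotomic_prime[OF assms] ..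
  have s: "s > 0" using assms prime_gt_0_nat by blast
  have "degree (level_poly s r) \<le> s - 1" by (rule degree_le) (auto simp: coeff_level_poly)
  moreover have "degree (level_poly s (\<lambda>_. 1)) \<ge> s - 1" by (rule le_degree) (use s in \<open>simp add: coeff_level_poly\<close>)
  moreover have "level_poly s (\<lambda>_. 1) \<noteq> 0" using s by (auto simp: poly_eq_iff coeff_level_poly)
  ultimately have "degree q = 0"
    using q by (cases "q = 0") (auto simp: degree_mult_eq)
  then obtain b where "q = [:b:]" by (rule degree_eq_zeroE)
  then have "coeff (level_poly s r) k = b" if "k < s" for k
    using that q by (simp add: coeff_level_poly)
  then have b: "of_nat (r k) = b" if "k < s" for k
    using that coeff_level_poly[of s r k] by simp
  have "r k = r 0" if "k < s" for k
    using b[OF that] b[OF s] by (metis of_nat_eq_iff)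
  then show "\<exists>r0. \<forall>k<s. r k = r0" by blast
next
  assume "\<exists>r0. \<forall>k<s. r k = r0"
  then obtain r0 where "\<forall>k<s. r k = r0" ..
  then have "level_poly s r = level_poly s (\<lambda>_. 1) * [:of_nat r0:]"
    by (simp add: poly_eq_iff coeff_level_poly)
  then show "cyclotomic s dvd level_poly s r" unfolding cyclotomic_prime[OF assms] by (rule dvdI)
qed

text \<open>Both \<open>X\<^sup>s - 1\<close> and the product that it has to divide contain the cyclotomic polynomials of the
  proper divisors of \<open>s\<close>; cancelling them leaves divisibility by the cyclotomic polynomial of \<open>s\<close>.\<close>

lemma tilde_poly_eq_0_iff:
  assumes "s > 0"
  shows "tilde_poly s r = 0 \<longleftrightarrow> cyclotomic s dvd level_poly s r"
proof -
  let ?T = "\<Prod>d\<in>{d. d dvd s \<and> d \<noteq> s}. cyclotomic d"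
  have "lead_coeff ?T = 1" by (simp add: lead_coeff_prod lead_coeff_cyclotomic)
  then have "?T \<noteq> 0" by auto
  then show ?thesis
    by (simp add: tilde_poly_def mod_eq_0_iff_dvd flip: cyclotomic_mult_proper_divisors[OF assms])
qed

text \<open>Multiplication by an element \<open>h \<noteq> 1\<close> of the subgroup permutes the coset, so the sum \<open>\<sigma>\<close> of the
  coset satisfies \<open>h \<sigma> = \<sigma>\<close>.\<close>

lemma sum_lateral_indicator:
  assumes "s > 0" "lateral_indicator s g"
  shows "(\<Sum>k<s. of_nat (g k) * omega s k) = 0"
proof -
  let ?C = "omega s ` {k. k < s \<and> g k = 1}" and ?G = "Omega_group s"
  obtain H where g: "\<forall>k<s. g k \<in> {0, 1}" and H: "subgroup H ?G" "H \<noteq> {1}" "?C \<in> rcosets\<^bsub>?G\<^esub> H"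
    using assms(2) by (auto simp: lateral_indicator_def)
  obtain a where "?C = H #>\<^bsub>?G\<^esub> a"
    using H(3) unfolding RCOSETS_def by blast
  also have "\<dots> = (\<lambda>h. h * a) ` H"
    by (auto simp: r_coset_def Omega_group_def)
  finally have C: "?C = (\<lambda>h. h * a) ` H" .
  have "1 \<in> H" using subgroup.one_closed[OF H(1)] by (simp add: Omega_group_def)
  then obtain h where h: "h \<in> H" "h \<noteq> 1" using H(2) by blast
  have "H \<subseteq> Omega s" using subgroup.subset[OF H(1)] by (simp add: Omega_group_def)
  then have "h \<noteq> 0"
    using assms(1) h by (auto simp: Omega_def power_0_left)
  have "x * y \<in> H" if "x \<in> H" "y \<in> H" for x y
    using subgroup.m_closed[OF H(1) that] by (simp add: Omega_group_def)
  then have sub: "(*) h ` ?C \<subseteq> ?C" unfolding C using h(1) by (auto simp: mult.assoc[symmetric])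
  have inj: "inj_on ((*) h) ?C" using \<open>h \<noteq> 0\<close> by (auto simp: inj_on_def)
  have "finite ?C" by simp
  then have perm: "(*) h ` ?C = ?C" using sub inj by (rule endo_inj_surj)
  have "h * \<Sum>?C = (\<Sum>z\<in>?C. h * z)" by (simp only: sum_distrib_left)
  also have "\<dots> = \<Sum>((*) h ` ?C)"
    using sum.reindex[OF inj, of "\<lambda>z. z"] by (simp only: o_def)
  finally have "h * \<Sum>?C = \<Sum>?C" by (simp only: perm)
  then have "\<Sum>?C = 0" using h(2) unfolding mult_cancel_right2 by blast
  moreover have "inj_on (omega s) {k. k < s \<and> g k = 1}"
    using bij_betw_omega[OF assms(1)] by (auto simp: bij_betw_def inj_on_def)
  then have "\<Sum>?C = (\<Sum>k | k < s \<and> g k = 1. omega s k)" by (simp add: sum.reindex)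
  moreover have "(\<Sum>k<s. of_nat (g k) * omega s k) = (\<Sum>k | k < s \<and> g k = 1. omega s k)"
    by (rule sum.mono_neutral_cong_right) (use g in auto)
  ultimately show ?thesis by simp
qed

section \<open>Centered terms\<close>

theorem proposition3:
  fixes m s :: nat and n \<alpha> r :: "nat \<Rightarrow> nat" and F :: "(nat \<Rightarrow> complex) multiset"
  assumes "\<forall>j\<in>{1..m}. n j > 0"
    and "\<alpha> \<in> exponents m n"
    and "s > 0" and "X_term m \<alpha> ` full_design m n = Omega s"
    and "fraction m n F"
    and "\<forall>k<s. r k = size {#\<zeta> \<in># F. X_term m \<alpha> \<zeta> = omega s k#}"
  shows
    "(centered (X_term m \<alpha>) F \<longleftrightarrow>
        (\<exists>\<Psi> :: int poly. level_poly s r = cyclotomic s * map_poly of_int \<Psi>)) \<and>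
     (prime s \<longrightarrow>
        (centered (X_term m \<alpha>) F \<longleftrightarrow> (\<exists>r0. \<forall>k<s. r k = r0))) \<and>
     (\<forall>d (p :: nat \<Rightarrow> nat) h. (\<forall>i\<in>{1..d}. prime (p i)) \<and> s = (\<Prod>i\<in>{1..d}. p i ^ h i) \<longrightarrow>
        (centered (X_term m \<alpha>) F \<longleftrightarrow> remainder_poly s r = 0) \<and>
        (\<exists>c :: nat \<Rightarrow> nat \<Rightarrow> int. \<forall>r' j.
           coeff (remainder_poly s r') j = (\<Sum>k<s. of_int (c j k) * of_nat (r' k))) \<and>
        (centered (X_term m \<alpha>) F \<longleftrightarrow> tilde_poly s r = 0) \<and>
        degree (tilde_poly s r) < s \<and>
        (\<exists>c :: nat \<Rightarrow> nat \<Rightarrow> int. \<forall>r' j.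
           coeff (tilde_poly s r') j = (\<Sum>k<s. of_int (c j k) * of_nat (r' k)))) \<and>
     (\<forall>N (a :: nat \<Rightarrow> nat) (g :: nat \<Rightarrow> nat \<Rightarrow> nat).
        (\<forall>i<N. a i > 0 \<and> lateral_indicator s (g i)) \<and>
        (\<forall>k<s. r k = (\<Sum>i<N. a i * g i k)) \<longrightarrow>
        centered (X_term m \<alpha>) F)"
proof -
  note s = \<open>s > 0\<close>
  have centered_iff: "centered (X_term m \<alpha>) F \<longleftrightarrow> (\<Sum>k<s. of_nat (r k) * omega s k) = 0"
    using assms by (intro centered_iff_sum_levels)
  obtain c where c: "cyclotomic s = complex_poly c" "lead_coeff c = 1"
    using cyclotomic_integral[OF s] .
  have factor: "centered (X_term m \<alpha>) F \<longleftrightarrow>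
      (\<exists>\<Psi> :: int poly. level_poly s r = cyclotomic s * map_poly of_int \<Psi>)"
    unfolding centered_iff poly_level_poly_omega [symmetric] level_poly_integral
    by (rule omega_root_iff_cyclotomic_dvd[OF s])
  have dvd: "centered (X_term m \<alpha>) F \<longleftrightarrow> cyclotomic s dvd level_poly s r"
  proof
    assume "cyclotomic s dvd level_poly s r"
    then obtain h where "level_poly s r = cyclotomic s * h" ..
    then show "centered (X_term m \<alpha>) F"
      unfolding factor using complex_poly_div_monic[OF c(2)] by (metis c(1) level_poly_integral)
  qed (auto simp: factor)
  have remainder: "remainder_poly s r = 0 \<longleftrightarrow> cyclotomic s dvd level_poly s r"
    by (simp add: remainder_poly_def mod_eq_0_iff_dvd)
  have remainder_coeffs: "\<exists>c :: nat \<Rightarrow> nat \<Rightarrow> int. \<forall>r' j.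
      coeff (remainder_poly s r') j = (\<Sum>k<s. of_int (c j k) * of_nat (r' k))"
    using coeff_mod_integral_combination[OF c(2), of s 1] by (simp add: remainder_poly_def c(1))
  have "\<forall>d\<in>{d. d dvd s \<and> d \<noteq> s}. \<exists>c. cyclotomic d = complex_poly c"
    using s cyclotomic_integral by (metis (lifting) dvd_pos_nat mem_Collect_eq)
  then obtain t where t: "\<And>d. d \<in> {d. d dvd s \<and> d \<noteq> s} \<Longrightarrow> cyclotomic d = complex_poly (t d)"
    by metis
  have tilde_coeffs: "\<exists>c :: nat \<Rightarrow> nat \<Rightarrow> int. \<forall>r' j.
      coeff (tilde_poly s r') j = (\<Sum>k<s. of_int (c j k) * of_nat (r' k))"
    using coeff_mod_integral_combination[OF monic_monom_minus_one(2)[OF s], of s "\<Prod>d\<in>{d. d dvd s \<and> d \<noteq> s}. t d"] t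
    by (simp add: tilde_poly_def complex_poly_prod complex_poly_diff map_poly_monom)
  have "monom 1 s - 1 \<noteq> (0 :: complex poly)"
    using monic_monom_minus_one(1)[OF s, where 'a = complex] s by auto
  from degree_mod_less[OF this] have degree: "degree (tilde_poly s r) < s"
    unfolding tilde_poly_def using s by (metis degree_0 monic_monom_minus_one(1)[OF s, where 'a = complex])
  have lateral: "centered (X_term m \<alpha>) F"
    if g: "\<forall>i<N. a i > 0 \<and> lateral_indicator s (g i)" and r: "\<forall>k<s. r k = (\<Sum>i<N. a i * g i k)"
    for N and a :: "nat \<Rightarrow> nat" and g :: "nat \<Rightarrow> nat \<Rightarrow> nat"
  proof -
    have "(\<Sum>k<s. of_nat (r k) * omega s k) = (\<Sum>k<s. \<Sum>i<N. of_nat (a i) * (of_nat (g i k) * omega s k))"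
      using r by (simp add: sum_distrib_right mult.assoc)
    also have "\<dots> = (\<Sum>i<N. \<Sum>k<s. of_nat (a i) * (of_nat (g i k) * omega s k))"
      by (rule sum.swap)
    also have "\<dots> = (\<Sum>i<N. of_nat (a i) * (\<Sum>k<s. of_nat (g i k) * omega s k))"
      by (simp add: sum_distrib_left)
    also have "\<dots> = 0"
      using g sum_lateral_indicator[OF s] by simp
    finally show ?thesis by (simp add: centered_iff)
  qed
  show ?thesis
  proof (intro conjI impI allI)
    assume "prime s"
    then show "centered (X_term m \<alpha>) F \<longleftrightarrow> (\<exists>r0. \<forall>k<s. r k = r0)"
      by (simp add: dvd cyclotomic_prime_dvd_level_poly_iff)
  next
    show "centered (X_term m \<alpha>) F \<longleftrightarrow> remainder_poly s r = 0"
      using dvd remainder by simp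
    show "centered (X_term m \<alpha>) F \<longleftrightarrow> tilde_poly s r = 0"
      using dvd tilde_poly_eq_0_iff[OF s] by simp
  qed (rule factor remainder_coeffs tilde_coeffs degree | erule conjE, rule lateral, assumption+)+
qed

end
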